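(* Consider the problem of minimizing $f(X)=g(\mathcal{A}X)+\langle C,X\rangle$ over the spectrahedron $\mathcal{S}_n$, with unique optimal solution $X_\star$ of rank $r_\star$ and dual solution $(Z_\star,s_\star)$. Then the eigengap condition $$\lambda_{n-r_\star}(\nabla f(X_\star))-\lambda_n(\nabla f(X_\star))>0$$ holds if and only if strict complementarity holds, i.e. $\mathrm{rank}(X_\star)+\mathrm{rank}(Z_\star)=n$.
   Context: Setting. $\mathbb{S}^n$ is the space of real symmetric $n\times n$ matrices with the trace inner product $\langle\cdot,\cdot\rangle$. For $A\in\mathbb{S}^n$, $\lambda_i(A)$ is the $i$-th largest eigenvalue. $\mathcal{S}_n=\{X\in\mathbb{S}^n: X\succeq 0,\ \mathrm{tr}(X)=1\}$. $C\in\mathbb{S}^n$, $\mathcal{A}:\mathbb{S}^n\to\mathbb{R}^m$ is linear, and $g:\mathbb{R}^m\to\mathbb{R}$ is convex and differentiable with Lipschitz continuous gradient. The problem is: minimize $f(X):=g(\mathcal{A}X)+\langle C,X\rangle$ subject to $X\in\mathcal{S}_n$. KKT condition: there are $Z_\star\in\mathbb{S}^n$ and $s_\star\in\mathbb{R}$ (the dual solution, which is unique) with $\nabla f(X_\star)-Z_\star-s_\star I=0$, $\langle Z_\star,X_\star\rangle=0$, $\mathrm{tr}(X_\star)=1$, $Z_\star\succeq0$, $X_\star\succeq 0$. It is implicit that $\lambda_{n-r_\star}$ is defined, i.e. $r_\star<n$. *)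

theory Defs
  imports "HOL-Analysis.Analysis" "HOL-Computational_Algebra.Computational_Algebra"
begin

definition sym_mats :: "(real^'n^'n) set" where
  "sym_mats = {A. transpose A = A}"

definition psd :: "real^'n^'n \<Rightarrow> bool" where
  "psd A \<longleftrightarrow> A \<in> sym_mats \<and> (\<forall>v. 0 \<le> v \<bullet> (A *v v))"

definition spectrahedron :: "(real^'n^'n) set" where
  "spectrahedron = {X. psd X \<and> trace X = 1}"

text \<open>The library inner product on matrices is the trace inner product.\<close>

lemma inner_matrix_eq_trace:
  fixes A B :: "real^'n^'n"
  shows "A \<bullet> B = trace (transpose A ** B)"
  unfolding inner_vec_def trace_def matrix_matrix_mult_def transpose_def
  by (simp, rule sum.swap)

definition charpoly :: "real^'n^'n \<Rightarrow> real poly" where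
  "charpoly A = det (\<chi> i j. (if i = j then [:0, 1:] else 0) - [:A $ i $ j:])"

text \<open>Indices start at 1, so \<open>eigval CARD('n) A\<close> is the smallest eigenvalue of a
  symmetric \<open>A\<close>. For a non-symmetric matrix only the real eigenvalues are listed.\<close>

definition eigval :: "nat \<Rightarrow> real^'n^'n \<Rightarrow> real" where
  "eigval i A = rev (sorted_list_of_multiset (proots (charpoly A))) ! (i - 1)"

lemma poly_charpoly:
  fixes A :: "real^'n^'n"
  shows "poly (charpoly A) x = det (mat x - A)"
proof -
  have "poly (of_int (sign p) *
      (\<Prod>i\<in>UNIV. (\<chi> i j. (if i = j then [:0, 1:] else 0) - [:A $ i $ j:]) $ i $ p i)) x
    = of_int (sign p) * (\<Prod>i\<in>UNIV. (mat x - A) $ i $ p i)" for p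
    by (auto simp: poly_prod mat_def of_int_poly intro!: prod.cong)
  then show ?thesis
    unfolding charpoly_def det_def by (simp add: poly_sum)
qed

lemma poly_charpoly_eq_0_iff:
  fixes A :: "real^'n^'n"
  shows "poly (charpoly A) x = 0 \<longleftrightarrow> (\<exists>v. v \<noteq> 0 \<and> A *v v = x *\<^sub>R v)"
proof -
  have "mat x *v v = x *\<^sub>R v" for v :: "real^'n"
    by (simp add: vec_eq_iff matrix_vector_mult_def mat_def if_distrib[of "\<lambda>a. a * _"]
        sum.delta' cong: if_cong)
  then have "(mat x - A) *v v = 0 \<longleftrightarrow> A *v v = x *\<^sub>R v" for v
    by (auto simp: matrix_vector_mult_diff_rdistrib)
  moreover have "det (mat x - A) = 0 \<longleftrightarrow> (\<exists>v. v \<noteq> 0 \<and> (mat x - A) *v v = 0)"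
    using invertible_det_nz[of "mat x - A"] invertible_left_inverse[of "mat x - A"]
      matrix_left_invertible_ker[of "mat x - A"] by blast
  ultimately show ?thesis
    by (simp add: poly_charpoly)
qed

lemma charpoly_nonzero:
  fixes A :: "real^'n^'n"
  shows "charpoly A \<noteq> 0"
proof
  assume "charpoly A = 0"
  then obtain v where v: "v \<noteq> 0" "A *v v = (onorm ((*v) A) + 1) *\<^sub>R v"
    using poly_charpoly_eq_0_iff[of A "onorm ((*v) A) + 1"] by auto
  have "norm (A *v v) \<le> onorm ((*v) A) * norm v"
    by (simp add: onorm matrix_vector_mul_bounded_linear)
  moreover have "norm (A *v v) = (onorm ((*v) A) + 1) * norm v"
    using v(2) onorm_pos_le[OF matrix_vector_mul_bounded_linear, of A] by simp
  ultimately show False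
    using v(1) by (simp add: algebra_simps)
qed

lemma set_mset_proots_charpoly:
  fixes A :: "real^'n^'n"
  shows "set_mset (proots (charpoly A)) = {x. \<exists>v. v \<noteq> 0 \<and> A *v v = x *\<^sub>R v}"
  by (simp add: charpoly_nonzero poly_charpoly_eq_0_iff)

definition linear_on_sym :: "(real^'n^'n \<Rightarrow> real^'m) \<Rightarrow> bool" where
  "linear_on_sym \<A> \<longleftrightarrow>
    (\<forall>X\<in>sym_mats. \<forall>Y\<in>sym_mats. \<A> (X + Y) = \<A> X + \<A> Y) \<and>
    (\<forall>c. \<forall>X\<in>sym_mats. \<A> (c *\<^sub>R X) = c *\<^sub>R \<A> X)"

definition has_lipschitz_gradient :: "(real^'m \<Rightarrow> real) \<Rightarrow> bool" where
  "has_lipschitz_gradient g \<longleftrightarrow>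
    (\<exists>G L. (\<forall>x. GDERIV g x :> G x) \<and> L-lipschitz_on UNIV G)"

definition objective ::
  "(real^'m \<Rightarrow> real) \<Rightarrow> (real^'n^'n \<Rightarrow> real^'m) \<Rightarrow> real^'n^'n \<Rightarrow> real^'n^'n \<Rightarrow> real" where
  "objective g \<A> C X = g (\<A> X) + C \<bullet> X"

text \<open>The gradient is taken in the Euclidean space of symmetric matrices: it is symmetric,
  and values of \<open>f\<close> at non-symmetric matrices do not matter.\<close>

definition grad_sym :: "(real^'n^'n \<Rightarrow> real) \<Rightarrow> real^'n^'n \<Rightarrow> real^'n^'n" where
  "grad_sym f X =
    (THE G. G \<in> sym_mats \<and> (f has_derivative (\<lambda>H. H \<bullet> G)) (at X within sym_mats))"

lemma grad_sym_eqI: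
  fixes f :: "real^'n^'n \<Rightarrow> real"
  assumes X: "X \<in> sym_mats" and G: "G \<in> sym_mats"
    and f: "(f has_derivative (\<lambda>H. H \<bullet> G)) (at X within sym_mats)"
  shows "grad_sym f X = G"
  unfolding grad_sym_def
proof (rule the_equality)
  show "G \<in> sym_mats \<and> (f has_derivative (\<lambda>H. H \<bullet> G)) (at X within sym_mats)"
    using G f by simp
next
  fix G' assume G': "G' \<in> sym_mats \<and> (f has_derivative (\<lambda>H. H \<bullet> G')) (at X within sym_mats)"
  define D where "D = G' - G"
  have line: "X + t *\<^sub>R D \<in> sym_mats" for t
    using X G G' unfolding D_def sym_mats_def
    by (simp add: transpose_def vec_eq_iff)
  have *: "((\<lambda>t. f (X + t *\<^sub>R D)) has_derivative (\<lambda>t. (t *\<^sub>R D) \<bullet> K)) (at 0)"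
    if "(f has_derivative (\<lambda>H. H \<bullet> K)) (at X within sym_mats)" for K
  proof -
    have "((\<lambda>t. X + t *\<^sub>R D) has_derivative (\<lambda>t. t *\<^sub>R D)) (at 0 within UNIV)"
      by (auto intro!: derivative_eq_intros)
    moreover have "(f has_derivative (\<lambda>H. H \<bullet> K))
        (at (X + 0 *\<^sub>R D) within range (\<lambda>t. X + t *\<^sub>R D))"
      using that line by (auto intro: has_derivative_subset)
    ultimately show ?thesis
      by (rule has_derivative_in_compose)
  qed
  have "(\<lambda>t::real. (t *\<^sub>R D) \<bullet> G) = (\<lambda>t. (t *\<^sub>R D) \<bullet> G')"
    using has_derivative_unique[OF *[OF f] *] G' by blast
  then have "D \<bullet> G = D \<bullet> G'"
    by (metis scaleR_one)
  then have "D \<bullet> D = 0"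
    unfolding D_def by (simp add: inner_diff_right)
  then show "G' = G"
    by (simp add: D_def)
qed

definition kkt ::
  "(real^'n^'n \<Rightarrow> real) \<Rightarrow> real^'n^'n \<Rightarrow> real^'n^'n \<Rightarrow> real \<Rightarrow> bool" where
  "kkt f X Z s \<longleftrightarrow>
    Z \<in> sym_mats \<and> grad_sym f X - Z - s *\<^sub>R mat 1 = 0 \<and> Z \<bullet> X = 0 \<and>
    trace X = 1 \<and> psd Z \<and> psd X"

end

theory Submission
  imports Defs
begin

text \<open>
  Write \<open>G\<close> for the gradient at the solution, \<open>r\<close> for the rank of the solution \<open>X\<close>, and \<open>n\<close> for
  the size of the matrices. Stationarity says \<open>G = Z + s I\<close>, so the eigenvalues of \<open>G\<close> are those
  of \<open>Z\<close> shifted by \<open>s\<close>. As \<open>Z\<close> is positive semidefinite and symmetric, exactly \<open>rank Z\<close> of its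
  \<open>n\<close> eigenvalues, counted with multiplicity, are positive, and the others vanish. Hence the
  \<open>i\<close>-th largest eigenvalue of \<open>G\<close> exceeds \<open>s\<close> iff \<open>i \<le> rank Z\<close>, and otherwise equals \<open>s\<close>.

  Complementarity \<open>Z \<bullet> X = 0\<close> forces \<open>X v = 0\<close> for every eigenvector \<open>v\<close> of \<open>Z\<close> with a positive
  eigenvalue, so \<open>rank X + rank Z \<le> n\<close> (lemma \<open>rank_add_rank_le\<close>). Moreover \<open>r \<ge> 1\<close>, because
  \<open>trace X = 1\<close>. Therefore \<open>rank Z < n\<close>, and the smallest eigenvalue of \<open>G\<close> is \<open>s\<close>; the eigengap
  condition becomes \<open>n - r \<le> rank Z\<close>, which given the reverse inequality is strict
  complementarity.

  The eigenvalue counts rest on the spectral theorem in the form of an orthonormal basis of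
  eigenvectors (\<open>orthonormal_eigenbasis_exists\<close>). The basis shows that the eigenvalues as roots
  of the characteristic polynomial, with multiplicities, are the eigenvalues of the basis vectors
  (\<open>proots_charpoly_eigenbasis\<close>), and that the rank counts the nonzero ones
  (\<open>rank_eigenbasis\<close>).
\<close>

section \<open>Spectral theorem for self-adjoint maps\<close>

text \<open>The minimum of a quadratic form is a critical point. The lemma serves twice: for the
  Rayleigh quotient on an invariant subspace, where it produces an eigenvector, and for a positive
  semidefinite matrix, where it shows that \<open>v \<bullet> X v = 0\<close> implies \<open>X v = 0\<close>.\<close>

lemma quadratic_form_zero_imp_inner_zero:
  fixes f :: "'a::real_inner \<Rightarrow> 'a"
  assumes f: "linear f" and adj: "\<And>x y. x \<bullet> f y = f x \<bullet> y"
    and S: "subspace S" and nonneg: "\<And>x. x \<in> S \<Longrightarrow> 0 \<le> x \<bullet> f x"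
    and v: "v \<in> S" "v \<bullet> f v = 0" and w: "w \<in> S"
  shows "w \<bullet> f v = 0"
proof (rule ccontr)
  define a where "a = w \<bullet> f v"
  define c where "c = w \<bullet> f w"
  assume "w \<bullet> f v \<noteq> 0"
  then have a: "a \<noteq> 0" by (simp add: a_def)
  have c: "c \<ge> 0" using nonneg[OF w] by (simp add: c_def)
  have ineq: "0 \<le> 2 * t * a + t^2 * c" for t
  proof -
    have "v + t *\<^sub>R w \<in> S"
      using S v(1) w by (simp add: subspace_add subspace_scale)
    then have "0 \<le> (v + t *\<^sub>R w) \<bullet> f (v + t *\<^sub>R w)"
      by (rule nonneg)
    also have "\<dots> = v \<bullet> f v + t * (v \<bullet> f w) + t * (w \<bullet> f v) + t^2 * (w \<bullet> f w)"
      by (simp add: linear_add[OF f] linear_scale[OF f] inner_add_left inner_add_right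
          power2_eq_square algebra_simps)
    also have "v \<bullet> f w = w \<bullet> f v"
      by (metis adj inner_commute)
    finally show ?thesis
      using v(2) by (simp add: a_def c_def)
  qed
  define u where "u = a / (c + 1)"
  have a_eq: "a = u * (c + 1)"
    using c by (simp add: u_def)
  \<comment> \<open>At \<open>t = - u\<close> the linear term outweighs the quadratic one.\<close>
  have "2 * (- u) * a + (- u)^2 * c = - (u^2 * (c + 2))"
    by (simp add: a_eq power2_eq_square algebra_simps)
  moreover have "u^2 * (c + 2) > 0"
    using a c a_eq by (intro mult_pos_pos) auto
  ultimately show False
    using ineq[of "- u"] by simp
qed

text \<open>The eigenvector is a maximizer of the Rayleigh quotient on the unit sphere of \<open>S\<close>.\<close>

lemma self_adjoint_eigenvector_exists:
  fixes f :: "'a::euclidean_space \<Rightarrow> 'a"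
  assumes f: "linear f" and adj: "\<And>x y. x \<bullet> f y = f x \<bullet> y"
    and S: "subspace S" and inv: "\<And>x. x \<in> S \<Longrightarrow> f x \<in> S" and ne: "\<exists>x\<in>S. x \<noteq> 0"
  shows "\<exists>v\<in>S. norm v = 1 \<and> (\<exists>\<mu>. f v = \<mu> *\<^sub>R v)"
proof -
  let ?K = "S \<inter> sphere 0 1"
  obtain x where x: "x \<in> S" "x \<noteq> 0" using ne by blast
  have "x /\<^sub>R norm x \<in> ?K"
    using x S by (simp add: subspace_scale)
  then have "?K \<noteq> {}" by blast
  moreover have "compact ?K"
    using S by (simp add: closed_subspace closed_Int_compact)
  moreover have "continuous_on ?K (\<lambda>x. x \<bullet> f x)"
    by (intro continuous_intros linear_continuous_on) (simp add: f linear_conv_bounded_linear[symmetric])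
  ultimately obtain v where "v \<in> ?K" and v_max: "\<forall>y\<in>?K. y \<bullet> f y \<le> v \<bullet> f v"
    using continuous_attains_sup[of ?K "\<lambda>x. x \<bullet> f x"] by blast
  then have v: "v \<in> S" "norm v = 1"
    by auto
  define \<mu> where "\<mu> = v \<bullet> f v"
  define h where "h = (\<lambda>x. \<mu> *\<^sub>R x - f x)"
  have h: "linear h"
    unfolding h_def by (intro linear_compose_sub f linear_compose_scale_right linear_ident)
  have hadj: "x \<bullet> h y = h x \<bullet> y" for x y
    by (simp add: h_def inner_diff_left inner_diff_right adj)
  have nonneg: "0 \<le> y \<bullet> h y" if "y \<in> S" for y
  proof (cases "y = 0")
    case False
    have "(y /\<^sub>R norm y) \<bullet> f (y /\<^sub>R norm y) \<le> \<mu>"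
      unfolding \<mu>_def using False that S by (intro bspec[OF v_max]) (simp add: subspace_scale)
    then have "y \<bullet> f y \<le> \<mu> * (norm y)^2"
      using False by (simp add: linear_scale[OF f] field_simps power2_eq_square)
    then show ?thesis
      by (simp add: h_def inner_diff_right power2_norm_eq_inner)
  qed simp
  have "v \<bullet> v = 1" using v(2) by (simp add: norm_eq_1)
  then have "v \<bullet> h v = 0"
    by (simp add: h_def inner_diff_right \<mu>_def)
  moreover have "h v \<in> S"
    using v(1) S inv by (simp add: h_def subspace_diff subspace_scale)
  ultimately have "h v \<bullet> h v = 0"
    using quadratic_form_zero_imp_inner_zero[OF h hadj S nonneg v(1)] by blast
  then have "f v = \<mu> *\<^sub>R v"
    by (simp add: h_def)
  then show ?thesis
    using v by blast
qed

text \<open>An orthonormal set of eigenvectors of the largest possible size spans the space: its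
  orthogonal complement is invariant, so a nonzero complement would contain one more
  eigenvector.\<close>

lemma self_adjoint_orthonormal_eigenvectors:
  fixes f :: "'a::euclidean_space \<Rightarrow> 'a"
  assumes f: "linear f" and adj: "\<And>x y. x \<bullet> f y = f x \<bullet> y"
  shows "\<exists>B. pairwise orthogonal B \<and> (\<forall>b\<in>B. norm b = 1 \<and> (\<exists>\<mu>. f b = \<mu> *\<^sub>R b)) \<and>
    finite B \<and> card B = DIM('a)"
proof -
  define P where "P = (\<lambda>B. pairwise orthogonal B \<and> (\<forall>b\<in>B. norm b = 1 \<and> (\<exists>\<mu>. f b = \<mu> *\<^sub>R b)))"
  have indep: "independent B" if "P B" for B
    using that by (intro pairwise_orthogonal_independent) (auto simp: P_def)
  have fin: "finite B" and bound: "card B \<le> DIM('a)" if "P B" for B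
    using independent_bound[OF indep[OF that]] by auto
  have "P {}" by (simp add: P_def)
  then obtain B where B: "P B" and greatest: "\<And>B'. P B' \<Longrightarrow> card B' \<le> card B"
    using ex_has_greatest_nat[of P "{}" card "DIM('a) + 1"] bound by (auto simp: less_Suc_eq_le)
  have "card B = DIM('a)"
  proof (rule ccontr)
    assume "card B \<noteq> DIM('a)"
    then have "dim B < DIM('a)"
      using bound[OF B] indep[OF B] by (simp add: dim_eq_card_independent)
    then obtain x where x: "x \<noteq> 0" "\<And>y. y \<in> span B \<Longrightarrow> orthogonal x y"
      using orthogonal_to_subspace_exists by blast
    define S where "S = {y. \<forall>b\<in>B. orthogonal b y}"
    have "subspace S"
      unfolding S_def by (rule subspace_orthogonal_to_vectors)
    moreover have "f y \<in> S" if "y \<in> S" for y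
    proof -
      have "b \<bullet> f y = 0" if "b \<in> B" for b
      proof -
        obtain \<mu> where "f b = \<mu> *\<^sub>R b" using B \<open>b \<in> B\<close> unfolding P_def by blast
        then show ?thesis
          using \<open>y \<in> S\<close> that by (simp add: adj S_def orthogonal_def)
      qed
      then show ?thesis by (simp add: S_def orthogonal_def)
    qed
    moreover have "x \<in> S"
      using x(2) by (auto simp: S_def orthogonal_commute span_base)
    ultimately obtain v where v: "v \<in> S" "norm v = 1" "\<exists>\<mu>. f v = \<mu> *\<^sub>R v"
      using self_adjoint_eigenvector_exists[OF f adj] x(1) by blast
    have "v \<notin> B"
      using v by (auto simp: S_def orthogonal_def norm_eq_1)
    moreover have "P (insert v B)"
      using B v by (auto simp: P_def S_def pairwise_insert orthogonal_commute)
    ultimately show False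
      using greatest[of "insert v B"] fin[OF B] by simp
  qed
  then show ?thesis
    using B fin[OF B] unfolding P_def by blast
qed

section \<open>Orthonormal eigenbases of matrices\<close>

definition orthonormal_eigenbasis ::
  "real^'n^'n \<Rightarrow> ('n \<Rightarrow> real^'n) \<Rightarrow> ('n \<Rightarrow> real) \<Rightarrow> bool" where
  "orthonormal_eigenbasis A b d \<longleftrightarrow>
    (\<forall>i j. b i \<bullet> b j = (if i = j then 1 else 0)) \<and> (\<forall>i. A *v b i = d i *\<^sub>R b i)"

lemma sym_mats_inner:
  assumes "A \<in> sym_mats"
  shows "x \<bullet> (A *v y) = (A *v x) \<bullet> y"
  using assms dot_lmul_matrix[of x A y]
  by (metis (mono_tags, lifting) mem_Collect_eq sym_mats_def transpose_matrix_vector)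

lemma orthonormal_eigenbasis_exists:
  fixes A :: "real^'n^'n"
  assumes "A \<in> sym_mats"
  shows "\<exists>b d. orthonormal_eigenbasis A b d"
proof -
  obtain B :: "(real^'n) set" where B: "pairwise orthogonal B" "finite B" "card B = CARD('n)"
      and eig: "\<And>v. v \<in> B \<Longrightarrow> norm v = 1 \<and> (\<exists>\<mu>. A *v v = \<mu> *\<^sub>R v)"
    using self_adjoint_orthonormal_eigenvectors[OF matrix_vector_mul_linear sym_mats_inner[OF assms]]
    by auto
  obtain b where b: "bij_betw b (UNIV :: 'n set) B"
    using finite_same_card_bij[of "UNIV :: 'n set" B] B by auto
  have "\<forall>i. \<exists>\<mu>. A *v b i = \<mu> *\<^sub>R b i"
    using eig bij_betwE[OF b] by blast
  then obtain d where "\<And>i. A *v b i = d i *\<^sub>R b i"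
    by metis
  moreover have "b i \<bullet> b j = (if i = j then 1 else 0)" for i j
  proof (cases "i = j")
    case True
    then show ?thesis using eig[of "b i"] bij_betwE[OF b] by (simp add: norm_eq_1)
  next
    case False
    then have "b i \<noteq> b j"
      using b by (auto simp: bij_betw_def inj_on_def)
    then show ?thesis
      using False B(1) bij_betwE[OF b] by (auto simp: pairwise_def orthogonal_def)
  qed
  ultimately show ?thesis
    unfolding orthonormal_eigenbasis_def by blast
qed

lemma orthonormal_eigenbasis_shift:
  assumes "orthonormal_eigenbasis A b d"
  shows "orthonormal_eigenbasis (A + s *\<^sub>R mat 1) b (\<lambda>i. d i + s)"
  using assms
  by (simp add: orthonormal_eigenbasis_def matrix_vector_mult_add_rdistrib
      scaleR_matrix_vector_assoc[symmetric] scaleR_add_left)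

text \<open>With \<open>Q\<close> the orthogonal matrix whose columns are the \<open>b i\<close>, the numbers \<open>b i \<bullet> M b j\<close> are
  the entries of \<open>Q\<^sup>T M Q\<close>, which is similar to \<open>M\<close>.\<close>

lemma orthonormal_change_of_basis:
  fixes M :: "real^'n^'n" and b :: "'n \<Rightarrow> real^'n"
  assumes b: "\<And>i j. b i \<bullet> b j = (if i = j then 1 else 0)"
  shows trace_orthonormal: "trace M = (\<Sum>i\<in>UNIV. b i \<bullet> (M *v b i))"
    and det_orthonormal: "det M = det (\<chi> i j. b i \<bullet> (M *v b j))"
proof -
  define Q :: "real^'n^'n" where "Q = (\<chi> k i. b i $ k)"
  have entry: "(transpose Q ** (N ** Q)) $ i $ j = b i \<bullet> (N *v b j)" for N i j
    by (simp add: Q_def matrix_matrix_mult_def transpose_def inner_vec_def matrix_vector_mult_def)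
  have "transpose Q ** Q = mat 1"
    using entry[of "mat 1"] unfolding vec_eq_iff by (simp add: b) (simp add: mat_def)
  then have Q: "transpose Q ** Q = mat 1" "Q ** transpose Q = mat 1"
    using matrix_left_right_inverse by blast+
  have M': "(\<chi> i j. b i \<bullet> (M *v b j)) = transpose Q ** (M ** Q)"
    by (simp add: vec_eq_iff entry)
  have "trace (transpose Q ** (M ** Q)) = trace ((M ** Q) ** transpose Q)"
    by (rule trace_mul_sym)
  also have "\<dots> = trace M"
    by (simp add: matrix_mul_assoc[symmetric] Q)
  finally show "trace M = (\<Sum>i\<in>UNIV. b i \<bullet> (M *v b i))"
    by (simp add: trace_def entry)
  have "det (transpose Q ** (M ** Q)) = det (transpose Q ** Q) * det M"
    by (simp only: det_mul mult_ac)
  then show "det M = det (\<chi> i j. b i \<bullet> (M *v b j))"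
    by (simp add: M' Q)
qed

lemma orthonormal_expand:
  fixes b :: "'n \<Rightarrow> real^'n"
  assumes b: "\<And>i j. b i \<bullet> b j = (if i = j then 1 else 0)"
  shows "(\<Sum>i\<in>UNIV. (x \<bullet> b i) *\<^sub>R b i) = x"
proof -
  have inj: "inj b"
    by (rule injI) (metis b zero_neq_one)
  have orth: "pairwise orthogonal (range b)"
    by (auto simp: pairwise_def orthogonal_def b)
  have "independent (range b)"
    using b by (intro pairwise_orthogonal_independent[OF orth]) (metis imageE inner_zero_left zero_neq_one)
  then have "UNIV \<subseteq> span (range b)"
    by (intro card_ge_dim_independent) (simp_all add: card_image[OF inj])
  then have "(\<Sum>v\<in>range b. (x \<bullet> v) *\<^sub>R v) = x"
    by (intro orthonormal_basis_expand[OF orth]) (auto simp: norm_eq_1 b)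
  then show ?thesis
    by (simp add: sum.reindex[OF inj])
qed

lemma proots_charpoly_eigenbasis:
  fixes A :: "real^'n^'n"
  assumes "orthonormal_eigenbasis A b d"
  shows "proots (charpoly A) = image_mset d (mset_set UNIV)"
proof -
  have b: "b i \<bullet> b j = (if i = j then 1 else 0)" and eig: "A *v b i = d i *\<^sub>R b i" for i j
    using assms by (auto simp: orthonormal_eigenbasis_def)
  have "poly (charpoly A) x = poly (\<Prod>i\<in>UNIV. [:- d i, 1:]) x" for x
  proof -
    have "mat x = x *\<^sub>R (mat 1 :: real^'n^'n)"
      by (simp add: vec_eq_iff mat_def)
    then have "(mat x - A) *v b j = (x - d j) *\<^sub>R b j" for j
      by (simp add: matrix_vector_mult_diff_rdistrib scaleR_matrix_vector_assoc[symmetric] eig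
          scaleR_diff_left)
    then have "det (mat x - A) = det (\<chi> i j. if i = j then x - d j else 0)"
      by (subst det_orthonormal[of b, OF b]) (simp add: b if_distrib cong: if_cong)
    also have "\<dots> = (\<Prod>i\<in>UNIV. x - d i)"
      by (subst det_diagonal) auto
    finally show ?thesis
      by (simp add: poly_charpoly poly_prod)
  qed
  then have "charpoly A = (\<Prod>i\<in>UNIV. [:- d i, 1:])"
    using poly_eq_poly_eq_iff by blast
  then have "proots (charpoly A) = (\<Sum>i\<in>UNIV. {#d i#})"
    by (simp add: proots_prod)
  also have "\<dots> = image_mset d (mset_set UNIV)"
    by (simp add: sum_unfold_sum_mset)
  finally show ?thesis .
qed

lemma rank_eigenbasis:
  fixes A :: "real^'n^'n"
  assumes "orthonormal_eigenbasis A b d"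
  shows "rank A = card {i. d i \<noteq> 0}"
proof -
  have b: "b i \<bullet> b j = (if i = j then 1 else 0)" and eig: "A *v b i = d i *\<^sub>R b i" for i j
    using assms by (auto simp: orthonormal_eigenbasis_def)
  let ?B = "b ` {i. d i \<noteq> 0}"
  have "A *v x \<in> span ?B" for x
  proof -
    have "A *v x = A *v (\<Sum>i\<in>UNIV. (x \<bullet> b i) *\<^sub>R b i)"
      by (simp add: orthonormal_expand[of b, OF b])
    also have "\<dots> = (\<Sum>i\<in>UNIV. (x \<bullet> b i) *\<^sub>R (d i *\<^sub>R b i))"
      by (simp add: linear_sum[OF matrix_vector_mul_linear] matrix_vector_mult_scaleR eig)
    also have "\<dots> \<in> span ?B"
    proof (rule span_sum)
      fix i
      show "(x \<bullet> b i) *\<^sub>R (d i *\<^sub>R b i) \<in> span ?B"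
        by (cases "d i = 0") (auto intro!: span_scale intro: span_base simp: span_zero)
    qed
    finally show ?thesis .
  qed
  moreover have "?B \<subseteq> range ((*v) A)"
  proof clarify
    fix i assume "d i \<noteq> 0"
    then have "b i = A *v (b i /\<^sub>R d i)"
      by (simp add: matrix_vector_mult_scaleR eig)
    then show "b i \<in> range ((*v) A)" by blast
  qed
  ultimately have "dim (range ((*v) A)) = dim ?B"
    by (intro antisym dim_subset dim_mono) auto
  moreover have "independent ?B"
  proof (rule pairwise_orthogonal_independent)
    show "pairwise orthogonal ?B"
      by (auto simp: pairwise_def orthogonal_def b)
    show "0 \<notin> ?B"
      using b by (metis imageE inner_zero_left zero_neq_one)
  qed
  moreover have "inj b"
    by (rule injI) (metis b zero_neq_one)
  ultimately show ?thesis
    by (simp add: rank_dim_range dim_eq_card_independent card_image inj_on_subset)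
qed

section \<open>Counting ordered eigenvalues\<close>

lemma nth_greater_iff_descending:
  fixes xs :: "'a::linorder list"
  assumes "sorted_wrt (\<ge>) xs" and "j < length xs"
  shows "xs ! j > t \<longleftrightarrow> j < length (filter (\<lambda>x. x > t) xs)"
  using assms
proof (induction xs arbitrary: j)
  case (Cons x xs)
  show ?case
  proof (cases "x > t")
    case True
    then show ?thesis using Cons by (cases j) auto
  next
    case False
    then have "\<forall>y\<in>set (x # xs). \<not> y > t"
      using Cons.prems(1) by fastforce
    then show ?thesis
      using Cons.prems(2) nth_mem[of j "x # xs"] by (auto simp: filter_empty_conv)
  qed
qed simp

text \<open>The form in which multiplicities enter: an eigenvalue in the ordered list is compared with a
  threshold by counting basis vectors.\<close>

lemma eigval_greater_iff:
  fixes A :: "real^'n^'n"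
  assumes A: "orthonormal_eigenbasis A b d" and k: "1 \<le> k" "k \<le> CARD('n)"
  shows "eigval k A > t \<longleftrightarrow> k \<le> card {i. d i > t}"
proof -
  define xs where "xs = rev (sorted_list_of_multiset (proots (charpoly A)))"
  have mset: "mset xs = image_mset d (mset_set UNIV)"
    by (simp add: xs_def proots_charpoly_eigenbasis[OF A])
  have "length xs = CARD('n)"
    using arg_cong[OF mset, of size] by simp
  moreover have "sorted_wrt (\<ge>) xs"
    by (simp add: xs_def sorted_wrt_rev)
  moreover have "length (filter (\<lambda>x. x > t) xs) = card {i. d i > t}"
    using arg_cong[OF mset, of "\<lambda>M. size (filter_mset (\<lambda>x. x > t) M)"]
    by (simp add: filter_mset_image_mset size_mset[symmetric] del: size_mset)
  ultimately show ?thesis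
    using nth_greater_iff_descending[of xs "k - 1" t] k
    by (auto simp: eigval_def xs_def)
qed

section \<open>Complementary positive semidefinite matrices\<close>

lemma psd_eigenvalue_nonneg:
  assumes "psd A" and "orthonormal_eigenbasis A b d"
  shows "0 \<le> d i"
proof -
  have "0 \<le> b i \<bullet> (A *v b i)"
    using assms(1) by (simp add: psd_def)
  then show ?thesis
    using assms(2) by (simp add: orthonormal_eigenbasis_def)
qed

text \<open>In an eigenbasis of \<open>Z\<close> the condition \<open>Z \<bullet> X = 0\<close> reads
  \<open>\<Sum>i. d i * (b i \<bullet> X b i) = 0\<close> with nonnegative terms. Hence \<open>X\<close> kills every \<open>b i\<close> with
  \<open>d i > 0\<close>, and by symmetry its range lies in the span of the remaining basis vectors.\<close>

lemma rank_add_rank_le: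
  fixes X Z :: "real^'n^'n"
  assumes X: "psd X" and Z: "psd Z" and compl: "Z \<bullet> X = 0"
  shows "rank X + rank Z \<le> CARD('n)"
proof -
  have symX: "X \<in> sym_mats" and symZ: "Z \<in> sym_mats"
    using X Z by (auto simp: psd_def)
  obtain b d where bd: "orthonormal_eigenbasis Z b d"
    using orthonormal_eigenbasis_exists[OF symZ] by blast
  have b: "b i \<bullet> b j = (if i = j then 1 else 0)" and eig: "Z *v b i = d i *\<^sub>R b i" for i j
    using bd by (auto simp: orthonormal_eigenbasis_def)
  have Xpos: "0 \<le> v \<bullet> (X *v v)" for v
    using X by (simp add: psd_def)
  have "Z \<bullet> X = trace (Z ** X)"
    using symZ by (simp add: inner_matrix_eq_trace sym_mats_def)
  also have "\<dots> = (\<Sum>i\<in>UNIV. b i \<bullet> (Z *v (X *v b i)))"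
    by (simp add: trace_orthonormal[of b, OF b] matrix_vector_mul_assoc)
  also have "\<dots> = (\<Sum>i\<in>UNIV. d i * (b i \<bullet> (X *v b i)))"
    by (simp add: sym_mats_inner[OF symZ] eig)
  finally have "d i * (b i \<bullet> (X *v b i)) = 0" for i
    using compl psd_eigenvalue_nonneg[OF Z bd] Xpos
    by (simp add: sum_nonneg_eq_0_iff)
  then have kill: "X *v b i = 0" if "d i \<noteq> 0" for i
  proof -
    have "b i \<bullet> (X *v b i) = 0"
      using \<open>d i * (b i \<bullet> (X *v b i)) = 0\<close> that by simp
    then have "(X *v b i) \<bullet> (X *v b i) = 0"
      using quadratic_form_zero_imp_inner_zero[OF matrix_vector_mul_linear
          sym_mats_inner[OF symX] subspace_UNIV Xpos UNIV_I _ UNIV_I] by blast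
    then show ?thesis by simp
  qed
  have "X *v x \<in> span (b ` {i. d i = 0})" for x
  proof -
    have "X *v x = (\<Sum>i\<in>UNIV. ((X *v x) \<bullet> b i) *\<^sub>R b i)"
      by (simp add: orthonormal_expand[of b, OF b])
    also have "\<dots> \<in> span (b ` {i. d i = 0})"
    proof (rule span_sum)
      fix i
      show "((X *v x) \<bullet> b i) *\<^sub>R b i \<in> span (b ` {i. d i = 0})"
        using kill[of i]
        by (cases "d i = 0")
          (auto intro!: span_scale intro: span_base simp: sym_mats_inner[OF symX, symmetric] span_zero)
    qed
    finally show ?thesis .
  qed
  then have "rank X \<le> card (b ` {i. d i = 0})"
    unfolding rank_dim_range by (intro dim_le_card) auto
  also have "\<dots> \<le> card {i. d i = 0}"
    by (rule card_image_le) simp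
  finally have "rank X + rank Z \<le> card {i. d i = 0} + card {i. d i \<noteq> 0}"
    by (simp add: rank_eigenbasis[OF bd])
  also have "\<dots> = card ({i. d i = 0} \<union> {i. d i \<noteq> 0})"
    by (rule card_Un_disjoint[symmetric]) auto
  also have "{i. d i = 0} \<union> {i. d i \<noteq> 0} = UNIV"
    by auto
  finally show ?thesis .
qed

section \<open>Eigengap and strict complementarity\<close>

theorem mainTheorem3:
  fixes g :: "real^'m \<Rightarrow> real"
    and \<A> :: "real^'n^'n \<Rightarrow> real^'m"
    and C X\<^sub>s Z\<^sub>s :: "real^'n^'n"
    and s\<^sub>s :: real
  assumes "convex_on UNIV g"
    and "has_lipschitz_gradient g"
    and "linear_on_sym \<A>"
    and "C \<in> sym_mats"
    and unique_solution:
      "\<And>X. is_arg_min (objective g \<A> C) (\<lambda>Y. Y \<in> spectrahedron) X \<longleftrightarrow> X = X\<^sub>s"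
    and dual_solution: "kkt (objective g \<A> C) X\<^sub>s Z\<^sub>s s\<^sub>s"
    and "rank X\<^sub>s < CARD('n)"
  shows "eigval (CARD('n) - rank X\<^sub>s) (grad_sym (objective g \<A> C) X\<^sub>s)
           - eigval CARD('n) (grad_sym (objective g \<A> C) X\<^sub>s) > 0
         \<longleftrightarrow> rank X\<^sub>s + rank Z\<^sub>s = CARD('n)"
proof -
  define G where "G = grad_sym (objective g \<A> C) X\<^sub>s"
  have Z: "Z\<^sub>s \<in> sym_mats" "psd Z\<^sub>s" and X: "psd X\<^sub>s" "trace X\<^sub>s = 1" and compl: "Z\<^sub>s \<bullet> X\<^sub>s = 0"
    and G: "G = Z\<^sub>s + s\<^sub>s *\<^sub>R mat 1"
    using dual_solution by (auto simp: kkt_def G_def algebra_simps)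
  obtain b d where bd: "orthonormal_eigenbasis Z\<^sub>s b d"
    using orthonormal_eigenbasis_exists[OF Z(1)] by blast
  note eigG = orthonormal_eigenbasis_shift[OF bd, of s\<^sub>s, folded G]
  have d: "0 \<le> d i" for i
    by (rule psd_eigenvalue_nonneg[OF Z(2) bd])
  then have "{i. d i + s\<^sub>s > s\<^sub>s} = {i. d i \<noteq> 0}"
    by (auto simp: less_le)
  then have above: "eigval k G > s\<^sub>s \<longleftrightarrow> k \<le> rank Z\<^sub>s" if "1 \<le> k" "k \<le> CARD('n)" for k
    using eigval_greater_iff[OF eigG that] by (simp add: rank_eigenbasis[OF bd])
  have le: "rank X\<^sub>s + rank Z\<^sub>s \<le> CARD('n)"
    by (rule rank_add_rank_le[OF X(1) Z(2) compl])
  have "X\<^sub>s \<noteq> 0"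
    using X(2) by (auto simp: trace_def)
  then have r: "rank X\<^sub>s > 0"
    by (simp add: rank_eq_0 zero_less_iff_neq_zero)
  have last: "eigval CARD('n) G = s\<^sub>s"
  proof (rule antisym)
    show "eigval CARD('n) G \<le> s\<^sub>s"
      using above[of "CARD('n)"] le r by (simp add: not_less[symmetric] Suc_leI)
    show "s\<^sub>s \<le> eigval CARD('n) G"
    proof (rule dense_le)
      fix t assume "t < s\<^sub>s"
      then have "{i. d i + s\<^sub>s > t} = UNIV"
        using d by (auto intro: add_nonneg_pos less_le_trans)
      then have "eigval CARD('n) G > t"
        using eigval_greater_iff[OF eigG, of "CARD('n)" t] by (simp add: Suc_leI)
      then show "t \<le> eigval CARD('n) G" by simp
    qed
  qed
  have "eigval (CARD('n) - rank X\<^sub>s) G > s\<^sub>s \<longleftrightarrow> CARD('n) - rank X\<^sub>s \<le> rank Z\<^sub>s"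
    using assms(7) by (intro above) auto
  then show ?thesis
    using last le by (auto simp: G_def)
qed

end
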